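(* Let $(Q,\lhd,\diamond)$ be a qualgebra and let $\chi,\lambda\colon Q\times Q\to\mathbb{Z}$ be two maps. Consider the weight function, denoted $(\chi,\lambda)$, on special points of $Q$-colored diagrams of well-oriented knotted $3$-valent graphs, given as follows. A crossing with over-arc colored $b$, under-arc on the right of the over-arc colored $a$ and under-arc on the left of the over-arc colored $a\lhd b$ has weight $\chi(a,b)$ if the under-strand is oriented from the $a$-colored arc to the $(a\lhd b)$-colored arc, and weight $-\chi(a,b)$ otherwise. For a vertex drawn with edges flowing from the top to the bottom of the page, an unzip vertex with outgoing arcs colored $a$ (bottom left) and $b$ (bottom right) has weight $\lambda(a,b)$, and a zip vertex with incoming arcs colored $a$ (top left) and $b$ (top right) has weight $-\lambda(a,b)$. The weight function $(\chi,\lambda)$ is Boltzmann if and only if for all $a,b,c\in Q$ one has \begin{align*} &\chi(a,b)+\chi(a\lhd b,c)=\chi(a\lhd c,b\lhd c)+\chi(a,c),\\ &\chi(a,a)=0,\\ &\chi(a,b\diamond c)=\chi(a,b)+\chi(a\lhd b,c),\\ &\chi(a\diamond b,c)+\lambda(a\lhd c,b\lhd c)=\chi(a,c)+\chi(b,c)+\lambda(a,b),\\ &\chi(a,b)+\lambda(a,b)=\lambda(b,a\lhd b). \end{align*}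
   Context: **Graphs and diagrams.** A knotted $3$-valent graph is an embedding of an abstract $3$-valent graph into $\mathbb{R}^3$; diagrams are its generic projections to $\mathbb{R}^2$ with over/under information at crossings. An oriented $3$-valent graph is well-oriented if each vertex is a zip vertex (two incoming edges, one outgoing) or an unzip vertex (one incoming edge, two outgoing). The special points of a diagram are its crossings and its $3$-valent vertices. An arc is a part of the diagram delimited by special points, where the over-strand is not cut at a crossing. A sub-diagram is a part of a diagram contained in a disc, e.g. either side of an R-move. "Right" and "left" of an over-arc are with respect to its orientation. **R-moves.** These are the local moves: I, II, III (the usual Reidemeister moves); IV (a strand passing under a $3$-valent vertex is moved from one side of the vertex to the other); V (a crossing between two edges adjacent to a vertex, located next to this vertex, is added or removed); VI (a strand passing over a $3$-valent vertex is moved from one side of the vertex to the other). All these moves are considered with all orientations for which the diagrams involved are well-oriented. **Qualgebras.** $(Q,\lhd,\diamond)$ is a qualgebra if there is a (necessarily unique) binary operation $\widetilde{\lhd}$ on $Q$ such that for all $a,b,c\in Q$: $(a\lhd b)\lhd c=(a\lhd c)\lhd(b\lhd c)$; $(a\lhd b)\,\widetilde{\lhd}\, b=(a\,\widetilde{\lhd}\, b)\lhd b=a$; $a\lhd a=a$; $a\lhd(b\diamond c)=(a\lhd b)\lhd c$; $(a\diamond b)\lhd c=(a\lhd c)\diamond(b\lhd c)$; $a\diamond b=b\diamond(a\lhd b)$. **Qualgebra colorings.** A $Q$-coloring of a (sub-)diagram is a map from its set of arcs to $Q$ such that: (A) at each crossing, if the over-arc has color $b$ and the under-arc lying to the right of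 the over-arc has color $a$, then the under-arc lying to the left of the over-arc has color $a\lhd b$; (B) at each vertex drawn with edges flowing from top to bottom: at a zip vertex with incoming arcs colored $a$ (top left) and $b$ (top right), the outgoing arc has color $a\diamond b$; at an unzip vertex with outgoing arcs colored $a$ (bottom left) and $b$ (bottom right), the incoming arc has color $a\diamond b$. These rules are topological: if $D'$ is obtained from $D$ by one R-move, every coloring $\mathcal{C}$ of $D$ corresponds to a unique coloring $\mathcal{C}'$ of $D'$ coinciding with $\mathcal{C}$ outside the small ball where the move is performed. **Boltzmann weight functions.** The weight of a colored (sub-)diagram is the sum of the weights of all its special points. A weight function is Boltzmann if, for any R-move, the weights of the two sub-diagrams involved, endowed with corresponding colorings, coincide. *)

theory Defs
  imports Main
begin

section \<open>Qualgebras\<close>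

locale qualgebra =
  fixes rhd :: "'q \<Rightarrow> 'q \<Rightarrow> 'q" (infixl "\<lhd>" 70)
    and dia :: "'q \<Rightarrow> 'q \<Rightarrow> 'q" (infixl "\<diamond>" 70)
  assumes self_distrib: "(a \<lhd> b) \<lhd> c = (a \<lhd> c) \<lhd> (b \<lhd> c)"
    and right_invertible: "\<exists>rhd'. \<forall>a b. rhd' (a \<lhd> b) b = a \<and> rhd' a b \<lhd> b = a"
    and idempotent: "a \<lhd> a = a"
    and act_dia: "a \<lhd> (b \<diamond> c) = (a \<lhd> b) \<lhd> c"
    and dia_distrib: "(a \<diamond> b) \<lhd> c = (a \<lhd> c) \<diamond> (b \<lhd> c)"
    and semi_comm: "a \<diamond> b = b \<diamond> (a \<lhd> b)"


section \<open>Sub-diagrams\<close>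

text \<open>
  Sub-diagrams, considered up to isotopy of the disc, are given by planar diagram codes.
  All the strands are cut at all the special points (at a crossing, the over-strand as well
  as the under-strand); the resulting pieces are the \<^emph>\<open>segments\<close>, numbered by naturals. Each
  segment is drawn with an arbitrary reference direction, from its tail to its head, which
  serves only to tell its two ends apart and has nothing to do with the orientation of the
  graph.
\<close>

datatype segment_end = Tail (segment: nat) | Head (segment: nat)

text \<open>
  The ends meeting at a special point are listed counterclockwise. In
  \<open>Crossing h0 h1 h2 h3\<close> the under-strand is \<open>h0\<close>--\<open>h2\<close> and the over-strand is \<open>h1\<close>--\<open>h3\<close>.
\<close>

datatype special_point =
    Crossing segment_end segment_end segment_end segment_end
  | Vertex segment_end segment_end segment_end

text \<open>The boundary lists, counterclockwise, the ends lying on the boundary of the disc.\<close>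

datatype subdiagram =
  Subdiagram (special_points: "special_point list") (boundary: "segment_end list")

fun ends_at :: "special_point \<Rightarrow> segment_end list" where
  "ends_at (Crossing h0 h1 h2 h3) = [h0, h1, h2, h3]"
| "ends_at (Vertex h0 h1 h2) = [h0, h1, h2]"

definition all_ends :: "subdiagram \<Rightarrow> segment_end list" where
  "all_ends D = concat (map ends_at (special_points D)) @ boundary D"

definition segments :: "subdiagram \<Rightarrow> nat set" where
  "segments D = segment ` set (all_ends D)"

definition well_formed :: "subdiagram \<Rightarrow> bool" where
  "well_formed D \<longleftrightarrow> distinct (all_ends D) \<and>
     (\<forall>e\<in>segments D. Tail e \<in> set (all_ends D) \<and> Head e \<in> set (all_ends D))"

text \<open>
  Since the over-strand is not cut at a crossing, an arc is a maximal set of segments linked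
  by over-passages.
\<close>

definition over_passages :: "subdiagram \<Rightarrow> (nat \<times> nat) set" where
  "over_passages D =
     {(segment h1, segment h3) | h0 h1 h2 h3. Crossing h0 h1 h2 h3 \<in> set (special_points D)}"

definition arc_of :: "subdiagram \<Rightarrow> nat \<Rightarrow> nat set" where
  "arc_of D e = {f. (e, f) \<in> (over_passages D \<union> (over_passages D)\<inverse>)\<^sup>*}"

definition arcs :: "subdiagram \<Rightarrow> nat set set" where
  "arcs D = arc_of D ` segments D"


section \<open>Orientations\<close>

text \<open>
  An orientation \<open>ori\<close> says of each segment whether it is oriented along its reference
  direction. \<open>incoming ori h\<close> means that the segment flows, at its end \<open>h\<close>, into the special
  point (or the boundary point) at which \<open>h\<close> lies.
\<close>

type_synonym orientation = "nat \<Rightarrow> bool"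

fun incoming :: "orientation \<Rightarrow> segment_end \<Rightarrow> bool" where
  "incoming ori (Head e) = ori e"
| "incoming ori (Tail e) = (\<not> ori e)"

definition zip_at :: "orientation \<Rightarrow> segment_end list \<Rightarrow> bool" where
  "zip_at ori hs \<longleftrightarrow> length (filter (incoming ori) hs) = 2 \<and> length hs = 3"

definition unzip_at :: "orientation \<Rightarrow> segment_end list \<Rightarrow> bool" where
  "unzip_at ori hs \<longleftrightarrow> length (filter (incoming ori) hs) = 1 \<and> length hs = 3"

fun well_oriented_at :: "orientation \<Rightarrow> special_point \<Rightarrow> bool" where
  "well_oriented_at ori (Crossing h0 h1 h2 h3) \<longleftrightarrow>
     incoming ori h0 \<noteq> incoming ori h2 \<and> incoming ori h1 \<noteq> incoming ori h3"
| "well_oriented_at ori (Vertex h0 h1 h2) \<longleftrightarrow>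
     zip_at ori [h0, h1, h2] \<or> unzip_at ori [h0, h1, h2]"

definition well_oriented :: "subdiagram \<Rightarrow> orientation \<Rightarrow> bool" where
  "well_oriented D ori \<longleftrightarrow> (\<forall>p\<in>set (special_points D). well_oriented_at ori p)"


section \<open>Colorings and weights\<close>

text \<open>
  What one sees around a special point whose ends carry colors, once the picture is turned so
  that vertices flow from top to bottom:
    \<^item> \<open>Colored_Crossing a b a' t\<close>: the over-arc has color \<open>b\<close>, the under-arc on its right has
      color \<open>a\<close>, the under-arc on its left has color \<open>a'\<close>, and \<open>t\<close> says whether the under-strand
      is oriented from right to left;
    \<^item> \<open>Colored_Unzip a b c\<close>: outgoing arcs \<open>a\<close> (bottom left), \<open>b\<close> (bottom right), incoming \<open>c\<close>;
    \<^item> \<open>Colored_Zip a b c\<close>: incoming arcs \<open>a\<close> (top left), \<open>b\<close> (top right), outgoing \<open>c\<close>.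
\<close>

datatype 'q colored_point =
    Colored_Crossing 'q 'q 'q bool
  | Colored_Unzip 'q 'q 'q
  | Colored_Zip 'q 'q 'q

text \<open>
  In \<open>colored_vertex ori c s h h'\<close> the end \<open>s\<close> is the one whose direction differs from the
  other two, and \<open>s, h, h'\<close> are listed counterclockwise. An unzip vertex has \<open>s\<close> at the top,
  so that \<open>h\<close> is at the bottom left; a zip vertex has \<open>s\<close> at the bottom, so that \<open>h\<close> is at the
  top right.
\<close>

definition colored_vertex ::
    "orientation \<Rightarrow> (segment_end \<Rightarrow> 'q) \<Rightarrow> segment_end \<Rightarrow> segment_end \<Rightarrow> segment_end
      \<Rightarrow> 'q colored_point" where
  "colored_vertex ori c s h h' =
     (if incoming ori s then Colored_Unzip (c h) (c h') (c s) else Colored_Zip (c h') (c h) (c s))"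

text \<open>
  An over-strand going from \<open>h1\<close> to \<open>h3\<close> has \<open>h2\<close> on its right and \<open>h0\<close> on its left.
\<close>

fun colored_point_at ::
    "orientation \<Rightarrow> (segment_end \<Rightarrow> 'q) \<Rightarrow> special_point \<Rightarrow> 'q colored_point" where
  "colored_point_at ori c (Crossing h0 h1 h2 h3) =
     (if incoming ori h1
      then Colored_Crossing (c h2) (c h1) (c h0) (incoming ori h2)
      else Colored_Crossing (c h0) (c h1) (c h2) (incoming ori h0))"
| "colored_point_at ori c (Vertex h0 h1 h2) =
     (if incoming ori h1 = incoming ori h2 then colored_vertex ori c h0 h1 h2
      else if incoming ori h2 = incoming ori h0 then colored_vertex ori c h1 h2 h0
      else colored_vertex ori c h2 h0 h1)"

definition end_color :: "subdiagram \<Rightarrow> (nat set \<Rightarrow> 'q) \<Rightarrow> segment_end \<Rightarrow> 'q" where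
  "end_color D C h = C (arc_of D (segment h))"

type_synonym 'q weight_function = "'q colored_point \<Rightarrow> int"

definition weight ::
    "'q weight_function \<Rightarrow> subdiagram \<Rightarrow> orientation \<Rightarrow> (nat set \<Rightarrow> 'q) \<Rightarrow> int" where
  "weight w D ori C =
     (\<Sum>p\<leftarrow>special_points D. w (colored_point_at ori (end_color D C) p))"

context qualgebra
begin

fun coloring_rule :: "'q colored_point \<Rightarrow> bool" where
  "coloring_rule (Colored_Crossing a b a' t) \<longleftrightarrow> a' = a \<lhd> b"
| "coloring_rule (Colored_Unzip a b c) \<longleftrightarrow> c = a \<diamond> b"
| "coloring_rule (Colored_Zip a b c) \<longleftrightarrow> c = a \<diamond> b"

text \<open>Only the values of \<open>C\<close> on \<open>arcs D\<close> matter.\<close>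

definition coloring :: "subdiagram \<Rightarrow> orientation \<Rightarrow> (nat set \<Rightarrow> 'q) \<Rightarrow> bool" where
  "coloring D ori C \<longleftrightarrow>
     (\<forall>p\<in>set (special_points D). coloring_rule (colored_point_at ori (end_color D C) p))"

end


section \<open>R-moves\<close>

text \<open>
  The two sides of each unoriented R-move, one representative for each move up to isotopy of
  the disc (rotations included, reflections not included) and exchange of the two sides. The
  boundary points of the two sides are matched by their position in the boundary lists.

  In \<open>crossing b h0 h1 h2 h3\<close> the ends are again listed counterclockwise, and the strand
  \<open>h0\<close>--\<open>h2\<close> passes over if \<open>b\<close>, under otherwise.
\<close>

definition crossing ::
    "bool \<Rightarrow> segment_end \<Rightarrow> segment_end \<Rightarrow> segment_end \<Rightarrow> segment_end \<Rightarrow> special_point" where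
  "crossing b h0 h1 h2 h3 = (if b then Crossing h1 h2 h3 h0 else Crossing h0 h1 h2 h3)"

inductive R_move :: "subdiagram \<Rightarrow> subdiagram \<Rightarrow> bool" where
  \<comment> \<open>a kink: segments 0 and 2 form the strand, 1 is the loop\<close>
  R_I: "R_move
     (Subdiagram [] [Tail 0, Head 0])
     (Subdiagram [crossing b (Head 0) (Tail 2) (Tail 1) (Head 1)] [Tail 0, Head 2])"
| \<comment> \<open>two vertical strands, with reference direction upwards; 0, 1, 2 (starting at the bottom
      left) passes over 3, 4, 5 (starting at the bottom right)\<close>
  R_II: "R_move
     (Subdiagram [] [Tail 0, Tail 1, Head 1, Head 0])
     (Subdiagram
        [crossing True (Head 0) (Head 3) (Tail 1) (Tail 4),
         crossing False (Head 4) (Head 1) (Tail 5) (Tail 2)]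
        [Tail 0, Tail 3, Head 5, Head 2])"
| \<comment> \<open>the braids with crossings in positions 1, 2, 1 and 2, 1, 2, read from bottom to top; the
      strands 0, 1, 2 and 3, 4, 5 and 6, 7, 8 start at the bottom left, middle and right;
      \<open>b\<close> decides which of the outer strands is the uppermost one\<close>
  R_III: "R_move
     (Subdiagram
        [crossing b (Head 0) (Head 3) (Tail 1) (Tail 4),
         crossing b (Head 1) (Head 6) (Tail 2) (Tail 7),
         crossing b (Head 4) (Head 7) (Tail 5) (Tail 8)]
        [Tail 0, Tail 3, Tail 6, Head 2, Head 5, Head 8])
     (Subdiagram
        [crossing b (Head 3) (Head 6) (Tail 4) (Tail 7),
         crossing b (Head 0) (Head 7) (Tail 1) (Tail 8),
         crossing b (Head 1) (Head 4) (Tail 2) (Tail 5)]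
        [Tail 0, Tail 3, Tail 6, Head 2, Head 5, Head 8])"
| \<comment> \<open>a Y-shaped vertex and a horizontal strand passing under its stem (left-hand side) or under
      its two branches (right-hand side). Left-hand side: 0, 1 is the strand from left to right,
      2, 3 the stem, 4 the left branch, 5 the right branch. Right-hand side: 0, 1, 2 is the
      strand, 3 the stem, 4, 5 the left branch, 6, 7 the right branch.\<close>
  R_IV: "R_move
     (Subdiagram
        [crossing False (Head 0) (Head 2) (Tail 1) (Tail 3),
         Vertex (Head 3) (Tail 5) (Tail 4)]
        [Tail 2, Head 1, Head 5, Head 4, Tail 0])
     (Subdiagram
        [Vertex (Head 3) (Tail 6) (Tail 4),
         crossing False (Head 0) (Head 4) (Tail 1) (Tail 5),
         crossing False (Head 1) (Head 6) (Tail 2) (Tail 7)]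
        [Tail 3, Head 2, Head 7, Head 5, Tail 0])"
| \<comment> \<open>a Y-shaped vertex with stem 0 whose branches 1 (left) and 2 (right) then cross, continuing
      as 3 to the right and 4 to the left\<close>
  R_V: "R_move
     (Subdiagram [Vertex (Head 0) (Tail 2) (Tail 1)] [Tail 0, Head 2, Head 1])
     (Subdiagram
        [Vertex (Head 0) (Tail 2) (Tail 1),
         crossing b (Head 1) (Head 2) (Tail 3) (Tail 4)]
        [Tail 0, Head 3, Head 4])"
| \<comment> \<open>as in move IV, with the horizontal strand passing over\<close>
  R_VI: "R_move
     (Subdiagram
        [crossing True (Head 0) (Head 2) (Tail 1) (Tail 3),
         Vertex (Head 3) (Tail 5) (Tail 4)]
        [Tail 2, Head 1, Head 5, Head 4, Tail 0])
     (Subdiagram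
        [Vertex (Head 3) (Tail 6) (Tail 4),
         crossing True (Head 0) (Head 4) (Tail 1) (Tail 5),
         crossing True (Head 1) (Head 6) (Tail 2) (Tail 7)]
        [Tail 3, Head 2, Head 7, Head 5, Tail 0])"

lemma R_move_well_formed:
  assumes "R_move D D'"
  shows "well_formed D" "well_formed D'" "length (boundary D) = length (boundary D')"
  using assms
  by (cases rule: R_move.cases;
      simp add: well_formed_def all_ends_def segments_def crossing_def)+


section \<open>Boltzmann weight functions\<close>

text \<open>
  Orientations of the two sides of an R-move that agree on the boundary make it an oriented
  R-move. Two colorings of the two sides correspond to each other if they are restrictions of
  colorings that coincide outside the disc, i.e. if they agree on the boundary.
\<close>

definition same_boundary_orientation ::
    "subdiagram \<Rightarrow> orientation \<Rightarrow> subdiagram \<Rightarrow> orientation \<Rightarrow> bool" where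
  "same_boundary_orientation D ori D' ori' \<longleftrightarrow>
     map (incoming ori) (boundary D) = map (incoming ori') (boundary D')"

definition same_boundary_colors ::
    "subdiagram \<Rightarrow> (nat set \<Rightarrow> 'q) \<Rightarrow> subdiagram \<Rightarrow> (nat set \<Rightarrow> 'q) \<Rightarrow> bool" where
  "same_boundary_colors D C D' C' \<longleftrightarrow>
     map (end_color D C) (boundary D) = map (end_color D' C') (boundary D')"

definition (in qualgebra) Boltzmann :: "'q weight_function \<Rightarrow> bool" where
  "Boltzmann w \<longleftrightarrow>
     (\<forall>D D' ori ori' C C'.
        R_move D D' \<longrightarrow>
        well_oriented D ori \<longrightarrow> well_oriented D' ori' \<longrightarrow>
        same_boundary_orientation D ori D' ori' \<longrightarrow>
        coloring D ori C \<longrightarrow> coloring D' ori' C' \<longrightarrow>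
        same_boundary_colors D C D' C' \<longrightarrow>
        weight w D ori C = weight w D' ori' C')"

fun qualgebra_weight ::
    "('q \<Rightarrow> 'q \<Rightarrow> int) \<Rightarrow> ('q \<Rightarrow> 'q \<Rightarrow> int) \<Rightarrow> 'q weight_function" where
  "qualgebra_weight \<chi> \<Lambda> (Colored_Crossing a b a' t) = (if t then \<chi> a b else - \<chi> a b)"
| "qualgebra_weight \<chi> \<Lambda> (Colored_Unzip a b c) = \<Lambda> a b"
| "qualgebra_weight \<chi> \<Lambda> (Colored_Zip a b c) = - \<Lambda> a b"

end

theory Submission
  imports Defs
begin

text \<open>
  In one well-chosen oriented version of each R-move except II, equality of the two weights is
  exactly one of the five identities: move III gives the first, move I the
  second, and moves IV, VI and V, with an unzip vertex, the third, fourth and fifth. As the free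
  colors of such a picture can be any elements of the qualgebra, the identities are necessary: this
  is the content of the lemmas \<open>Boltzmann_imp_cocycle\<close> to \<open>Boltzmann_imp_swap\<close>.

  For the converse, the other versions have to be deduced from the chosen ones. Reversing an
  under-strand only changes a sign. Reversing an over-strand of color \<open>b\<close> exchanges the two
  under-arcs, and so replaces \<open>\<lhd> b\<close> by its inverse; but the resulting identity is an instance of
  the original one, read from another arc. Reversing an edge at a vertex rotates the vertex, so
  that another of its three edges carries the product of the two remaining colors. For moves IV and
  VI this merely moves terms between the two sides of the identity, as these moves treat the three
  edges alike. Move V does not, since it crosses two of them. If one of the crossing edges carries
  the product, the passage is first decomposed by the identity of move IV or VI, where the second
  identity removes the passage of an edge under itself; what remains is the fifth identity. In move
  II the weights of the two crossings always cancel.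

  The orientations are handled by describing each special point by a rule that has the directions
  of its edges as parameters (\<open>passes\<close>, \<open>vertex_rule\<close>). The lemmas \<open>passages_exchange\<close>,
  \<open>passages_under_vertex\<close>, \<open>vertex_swap_branches\<close> and \<open>vertex_through_passage\<close> are the oriented
  identities behind moves III, IV, V and VI.
\<close>

section \<open>Colorings by segments\<close>

text \<open>
  Colors of segments are easier to compute with than colors of arcs: both sides of a move become
  finite lists of colors. A coloring of the segments comes from one of the arcs exactly when it is
  constant along over-strands.
\<close>

fun constant_along_over_strand :: "(nat \<Rightarrow> 'q) \<Rightarrow> special_point \<Rightarrow> bool" where
  "constant_along_over_strand col (Crossing h0 h1 h2 h3) \<longleftrightarrow> col (segment h3) = col (segment h1)"
| "constant_along_over_strand col (Vertex h0 h1 h2) \<longleftrightarrow> True"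

lemma arc_of_over_passage:
  assumes "Crossing h0 h1 h2 h3 \<in> set (special_points D)"
  shows "arc_of D (segment h3) = arc_of D (segment h1)"
proof -
  let ?R = "over_passages D \<union> (over_passages D)\<inverse>"
  have "(segment h1, segment h3) \<in> ?R" "(segment h3, segment h1) \<in> ?R"
    using assms by (auto simp: over_passages_def)
  then show ?thesis
    unfolding arc_of_def by (blast intro: converse_rtrancl_into_rtrancl)
qed

lemma constant_on_arc:
  assumes "\<forall>p\<in>set (special_points D). constant_along_over_strand col p"
    and "f \<in> arc_of D e"
  shows "col f = col e"
proof -
  have step: "col g = col f" if "(f, g) \<in> over_passages D" for f g
    using that assms(1) by (force simp: over_passages_def)
  have "(e, f) \<in> (over_passages D \<union> (over_passages D)\<inverse>)\<^sup>*"
    using assms(2) by (simp add: arc_of_def)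
  then show ?thesis
    by (induction rule: rtrancl_induct) (auto dest: step)
qed

lemma ex_arc_coloring:
  assumes "\<forall>p\<in>set (special_points D). constant_along_over_strand col p"
  shows "\<exists>C. \<forall>e. C (arc_of D e) = col e"
proof -
  have "e \<in> arc_of D e" for e by (simp add: arc_of_def)
  then have "(SOME f. f \<in> arc_of D e) \<in> arc_of D e" for e
    by (rule someI)
  then have "col (SOME f. f \<in> arc_of D e) = col e" for e
    by (rule constant_on_arc[OF assms])
  then show ?thesis
    by (intro exI[of _ "\<lambda>A. col (SOME f. f \<in> A)"]) simp
qed

definition segment_weight ::
    "'q weight_function \<Rightarrow> orientation \<Rightarrow> (nat \<Rightarrow> 'q) \<Rightarrow> special_point list \<Rightarrow> int" where
  "segment_weight w ori col ps = (\<Sum>p\<leftarrow>ps. w (colored_point_at ori (\<lambda>h. col (segment h)) p))"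

context qualgebra
begin

definition valid_at :: "orientation \<Rightarrow> (nat \<Rightarrow> 'q) \<Rightarrow> special_point \<Rightarrow> bool" where
  "valid_at ori col p \<longleftrightarrow> well_oriented_at ori p \<and> constant_along_over_strand col p \<and>
     coloring_rule (colored_point_at ori (\<lambda>h. col (segment h)) p)"

text \<open>
  The requirement that \<open>Boltzmann\<close> makes on one move, with segments in place of arcs. Being
  phrased with the bare lists of points and ends, it turns by simplification into equations
  between finitely many colors.
\<close>

fun weights_agree :: "'q weight_function \<Rightarrow> subdiagram \<Rightarrow> subdiagram \<Rightarrow> bool" where
  "weights_agree w (Subdiagram ps bs) (Subdiagram ps' bs') \<longleftrightarrow>
     (\<forall>ori ori' col col'.
        (\<forall>p\<in>set ps. valid_at ori col p) \<longrightarrow> (\<forall>p\<in>set ps'. valid_at ori' col' p) \<longrightarrow>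
        map (incoming ori) bs = map (incoming ori') bs' \<longrightarrow>
        map (\<lambda>h. col (segment h)) bs = map (\<lambda>h. col' (segment h)) bs' \<longrightarrow>
        segment_weight w ori col ps = segment_weight w ori' col' ps')"

lemma valid_of_coloring:
  assumes "well_oriented D ori" "coloring D ori C" "p \<in> set (special_points D)"
  shows "valid_at ori (\<lambda>e. C (arc_of D e)) p"
proof -
  have "constant_along_over_strand (\<lambda>e. C (arc_of D e)) p"
    by (cases p) (use assms(3) in \<open>auto dest: arc_of_over_passage\<close>)
  then show ?thesis
    using assms by (simp add: valid_at_def well_oriented_def coloring_def end_color_def[abs_def])
qed

lemma coloring_of_valid:
  assumes "\<forall>p\<in>set (special_points D). valid_at ori col p"
  obtains C where "coloring D ori C" "end_color D C = (\<lambda>h. col (segment h))"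
proof -
  obtain C where "\<forall>e. C (arc_of D e) = col e"
    using assms ex_arc_coloring[of D col] by (auto simp: valid_at_def)
  then have "end_color D C = (\<lambda>h. col (segment h))"
    by (simp add: end_color_def[abs_def])
  with assms that show thesis
    by (simp add: coloring_def valid_at_def)
qed

lemma Boltzmann_iff_weights_agree:
  "Boltzmann w \<longleftrightarrow> (\<forall>D D'. R_move D D' \<longrightarrow> weights_agree w D D')"
proof (intro iffI allI impI)
  fix D D' :: subdiagram
  assume B: "Boltzmann w" and R: "R_move D D'"
  obtain ps bs ps' bs' where D: "D = Subdiagram ps bs" "D' = Subdiagram ps' bs'"
    by (cases D, cases D')
  show "weights_agree w D D'"
    unfolding D weights_agree.simps
  proof (intro allI impI)
    fix ori ori' col col'
    assume v: "\<forall>p\<in>set ps. valid_at ori col p" "\<forall>p\<in>set ps'. valid_at ori' col' p"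
      and o: "map (incoming ori) bs = map (incoming ori') bs'"
      and b: "map (\<lambda>h. col (segment h)) bs = map (\<lambda>h. col' (segment h)) bs'"
    obtain C where C: "coloring D ori C" "end_color D C = (\<lambda>h. col (segment h))"
      by (rule coloring_of_valid[of D ori col]) (use v(1) D in auto)
    obtain C' where C': "coloring D' ori' C'" "end_color D' C' = (\<lambda>h. col' (segment h))"
      by (rule coloring_of_valid[of D' ori' col']) (use v(2) D in auto)
    have "well_oriented D ori" "well_oriented D' ori'"
      using v D by (auto simp: well_oriented_def valid_at_def)
    moreover have "same_boundary_orientation D ori D' ori'"
      using o D by (simp add: same_boundary_orientation_def)
    moreover have "same_boundary_colors D C D' C'"
      using b C(2) C'(2) D by (simp add: same_boundary_colors_def)
    ultimately have "weight w D ori C = weight w D' ori' C'"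
      using B R C(1) C'(1) unfolding Boltzmann_def by blast
    then show "segment_weight w ori col ps = segment_weight w ori' col' ps'"
      using C(2) C'(2) D by (simp add: weight_def segment_weight_def)
  qed
next
  assume P: "\<forall>D D'. R_move D D' \<longrightarrow> weights_agree w D D'"
  show "Boltzmann w"
    unfolding Boltzmann_def
  proof (intro allI impI)
    fix D D' ori ori' C C'
    assume R: "R_move D D'" and wo: "well_oriented D ori" "well_oriented D' ori'"
      and o: "same_boundary_orientation D ori D' ori'"
      and c: "coloring D ori C" "coloring D' ori' C'" and b: "same_boundary_colors D C D' C'"
    obtain ps bs ps' bs' where D: "D = Subdiagram ps bs" "D' = Subdiagram ps' bs'"
      by (cases D, cases D')
    let ?col = "\<lambda>e. C (arc_of D e)" and ?col' = "\<lambda>e. C' (arc_of D' e)"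
    have "weights_agree w (Subdiagram ps bs) (Subdiagram ps' bs')"
      using P R unfolding D by blast
    moreover have "\<forall>p\<in>set ps. valid_at ori ?col p" "\<forall>p\<in>set ps'. valid_at ori' ?col' p"
      using valid_of_coloring[OF wo(1) c(1)] valid_of_coloring[OF wo(2) c(2)] by (simp_all add: D)
    moreover have "map (incoming ori) bs = map (incoming ori') bs'"
      using o by (simp add: same_boundary_orientation_def D)
    moreover have "map (\<lambda>h. ?col (segment h)) bs = map (\<lambda>h. ?col' (segment h)) bs'"
      using b unfolding same_boundary_colors_def end_color_def[abs_def] by (simp add: D)
    ultimately have "segment_weight w ori ?col ps = segment_weight w ori' ?col' ps'"
      unfolding weights_agree.simps by blast
    then show "weight w D ori C = weight w D' ori' C'"
      by (simp add: weight_def segment_weight_def end_color_def[abs_def] D)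
  qed
qed

lemma rhd_cancel: "a \<lhd> c = b \<lhd> c \<longleftrightarrow> a = b"
  using right_invertible by metis

section \<open>Signed passages and rotated vertices\<close>

text \<open>
  A crossing seen from the under-strand: in \<open>passes \<epsilon> b a a'\<close> one leaves an arc of color \<open>a\<close>,
  goes under an arc of color \<open>b\<close> and reaches an arc of color \<open>a'\<close>, and \<open>\<epsilon>\<close> says whether the
  over-arc is directed so as to have \<open>a\<close> on its right. Here the direction of the walk has nothing
  to do with the orientation of the under-strand, which affects the weight only by a factor \<open>\<plusminus>1\<close>
  and the rule for colors not at all. For \<open>\<epsilon>\<close> false, \<open>a'\<close> is the result of
  applying the inverse of \<open>\<lhd> b\<close> to \<open>a\<close>.
\<close>

definition passes :: "bool \<Rightarrow> 'q \<Rightarrow> 'q \<Rightarrow> 'q \<Rightarrow> bool" where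
  "passes \<epsilon> b a a' \<longleftrightarrow> (if \<epsilon> then a' = a \<lhd> b else a = a' \<lhd> b)"

definition passage_weight :: "('q \<Rightarrow> 'q \<Rightarrow> int) \<Rightarrow> bool \<Rightarrow> 'q \<Rightarrow> 'q \<Rightarrow> 'q \<Rightarrow> int" where
  "passage_weight \<chi> \<epsilon> b a a' = (if \<epsilon> then \<chi> a b else - \<chi> a' b)"

lemma valid_at_Crossing:
  "valid_at ori col (Crossing h0 h1 h2 h3) \<longleftrightarrow>
     incoming ori h2 = (\<not> incoming ori h0) \<and> incoming ori h3 = (\<not> incoming ori h1) \<and>
     col (segment h3) = col (segment h1) \<and>
     passes (incoming ori h1) (col (segment h1)) (col (segment h2)) (col (segment h0))"
  by (auto simp: valid_at_def passes_def)

text \<open>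
  The ends of a vertex are listed counterclockwise, with \<open>i\<close> telling whether an end is incoming
  and \<open>x\<close> its color. The three branches are the rotations of one picture, in which the first end is
  the one whose direction differs from the other two. The conjunct \<open>i0 \<noteq> i1\<close> excludes sources
  and sinks.
\<close>

definition vertex_rule :: "bool \<Rightarrow> bool \<Rightarrow> bool \<Rightarrow> 'q \<Rightarrow> 'q \<Rightarrow> 'q \<Rightarrow> bool" where
  "vertex_rule i0 i1 i2 x0 x1 x2 \<longleftrightarrow>
     (if i1 = i2 then i0 \<noteq> i1 \<and> x0 = (if i0 then x1 \<diamond> x2 else x2 \<diamond> x1)
      else if i2 = i0 then x1 = (if i1 then x2 \<diamond> x0 else x0 \<diamond> x2)
      else x2 = (if i2 then x0 \<diamond> x1 else x1 \<diamond> x0))"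

definition vertex_weight ::
    "('q \<Rightarrow> 'q \<Rightarrow> int) \<Rightarrow> bool \<Rightarrow> bool \<Rightarrow> bool \<Rightarrow> 'q \<Rightarrow> 'q \<Rightarrow> 'q \<Rightarrow> int" where
  "vertex_weight \<Lambda> i0 i1 i2 x0 x1 x2 =
     (if i1 = i2 then if i0 then \<Lambda> x1 x2 else - \<Lambda> x2 x1
      else if i2 = i0 then if i1 then \<Lambda> x2 x0 else - \<Lambda> x0 x2
      else if i2 then \<Lambda> x0 x1 else - \<Lambda> x1 x0)"

lemma valid_at_Vertex:
  "valid_at ori col (Vertex h0 h1 h2) \<longleftrightarrow>
     vertex_rule (incoming ori h0) (incoming ori h1) (incoming ori h2)
       (col (segment h0)) (col (segment h1)) (col (segment h2))"
  by (auto simp: valid_at_def zip_at_def unzip_at_def vertex_rule_def colored_vertex_def)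

definition sign :: "bool \<Rightarrow> int" where
  "sign i = (if i then 1 else -1)"

lemma sign_not [simp]: "sign (\<not> i) = - sign i"
  by (simp add: sign_def)

lemma segment_weight_Nil: "segment_weight w ori col [] = 0"
  by (simp add: segment_weight_def)

lemma segment_weight_Crossing:
  assumes "valid_at ori col (Crossing h0 h1 h2 h3)"
  shows "segment_weight (qualgebra_weight \<chi> \<Lambda>) ori col (Crossing h0 h1 h2 h3 # ps) =
    sign (incoming ori h2) *
    passage_weight \<chi> (incoming ori h1) (col (segment h1)) (col (segment h2)) (col (segment h0))
    + segment_weight (qualgebra_weight \<chi> \<Lambda>) ori col ps"
  using assms by (simp add: valid_at_Crossing segment_weight_def passage_weight_def sign_def)

lemma segment_weight_Vertex:
  "segment_weight (qualgebra_weight \<chi> \<Lambda>) ori col (Vertex h0 h1 h2 # ps) =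
    vertex_weight \<Lambda> (incoming ori h0) (incoming ori h1) (incoming ori h2)
       (col (segment h0)) (col (segment h1)) (col (segment h2))
    + segment_weight (qualgebra_weight \<chi> \<Lambda>) ori col ps"
  by (simp add: segment_weight_def vertex_weight_def colored_vertex_def)

section \<open>Invariance under the moves\<close>

text \<open>
  These rules turn \<open>weights_agree\<close> for concrete sub-diagrams into a statement about signed
  passages and vertices, without a case distinction on orientations.
\<close>

lemmas local_rules =
  crossing_def valid_at_Crossing valid_at_Vertex segment_weight_Nil segment_weight_Crossing
  segment_weight_Vertex

text \<open>
  The over-arc of a kink consists of the loop and one of the two outer segments. The outer segments
  have the same color, as they do before the move; hence the strand passes under an arc of its own
  color.
\<close>

lemma weights_agree_R_I:
  assumes "\<And>a. \<chi> a a = 0"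
  shows "weights_agree (qualgebra_weight \<chi> \<Lambda>)
     (Subdiagram [] [Tail 0, Head 0])
     (Subdiagram [crossing b (Head 0) (Tail 2) (Tail 1) (Head 1)] [Tail 0, Head 2])"
  by (cases b; auto simp: local_rules passage_weight_def assms)

text \<open>
  The under-strand passes the same arc from one side and back from the other, so the two weights
  cancel.
\<close>

lemma weights_agree_R_II:
  shows "weights_agree (qualgebra_weight \<chi> \<Lambda>)
     (Subdiagram [] [Tail 0, Tail 1, Head 1, Head 0])
     (Subdiagram
        [crossing True (Head 0) (Head 3) (Tail 1) (Tail 4),
         crossing False (Head 4) (Head 1) (Tail 5) (Tail 2)]
        [Tail 0, Tail 3, Head 5, Head 2])"
  by (auto simp: local_rules passage_weight_def passes_def sign_def rhd_cancel)

text \<open>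
  The two walks lead under \<open>b\<close> and then under \<open>c\<close>, and under \<open>c\<close> and then under the arc \<open>b'\<close> that
  \<open>b\<close> becomes behind \<open>c\<close>. Whatever the signs, all colors are obtained by \<open>\<lhd>\<close> from \<open>c\<close>, one of
  \<open>b\<close>, \<open>b'\<close> and the color of one arc of the under-strand: this color is \<open>a\<close>, \<open>a1\<close>, \<open>a1'\<close> or \<open>a2\<close>
  in the four cases, and the identity is applied to it.
\<close>

lemma passages_exchange:
  assumes "\<And>a b c. \<chi> a b + \<chi> (a \<lhd> b) c = \<chi> (a \<lhd> c) (b \<lhd> c) + \<chi> a c"
  assumes "passes \<epsilon> b a a1" "passes \<gamma> c a1 a2"
    "passes \<gamma> c a a1'" "passes \<gamma> c b b'" "passes \<epsilon> b' a1' a2"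
  shows "passage_weight \<chi> \<epsilon> b a a1 + passage_weight \<chi> \<gamma> c a1 a2 =
   passage_weight \<chi> \<gamma> c a a1' + passage_weight \<chi> \<epsilon> b' a1' a2"
  using assms(2-) assms(1)[of a b c] assms(1)[of a1 b c] assms(1)[of a1' b' c] assms(1)[of a2 b' c]
  by (cases \<epsilon>; cases \<gamma>; clarsimp simp: passes_def passage_weight_def)

text \<open>
  The lowest strand goes along one walk of \<open>passages_exchange\<close> on the left-hand side of the move and
  along the other on the right-hand side. The crossing of the two upper strands, where \<open>b\<close> becomes
  \<open>b'\<close>, has the same weight on both sides.
\<close>

lemma weights_agree_R_III:
  assumes "\<And>a b c. \<chi> a b + \<chi> (a \<lhd> b) c = \<chi> (a \<lhd> c) (b \<lhd> c) + \<chi> a c"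
  shows "weights_agree (qualgebra_weight \<chi> \<Lambda>)
     (Subdiagram
        [crossing b (Head 0) (Head 3) (Tail 1) (Tail 4),
         crossing b (Head 1) (Head 6) (Tail 2) (Tail 7),
         crossing b (Head 4) (Head 7) (Tail 5) (Tail 8)]
        [Tail 0, Tail 3, Tail 6, Head 2, Head 5, Head 8])
     (Subdiagram
        [crossing b (Head 3) (Head 6) (Tail 4) (Tail 7),
         crossing b (Head 0) (Head 7) (Tail 1) (Tail 8),
         crossing b (Head 1) (Head 4) (Tail 2) (Tail 5)]
        [Tail 0, Tail 3, Tail 6, Head 2, Head 5, Head 8])"
proof (cases b)
  case True
  then show ?thesis
    apply (clarsimp simp: local_rules)
    subgoal for ori ori' col col'
      using passages_exchange[where \<chi> = \<chi>, OF assms, of "\<not> ori' 4" "col' 5" "col' 8"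
        "col 7" "\<not> ori' 2" "col' 2" "col' 6" "col' 7" "col' 4"]
      by (simp add: sign_def)
    done
next
  case False
  then show ?thesis
    apply (clarsimp simp: local_rules)
    subgoal for ori ori' col col'
      using passages_exchange[where \<chi> = \<chi>, OF assms, of "ori' 3" "col' 4" "col' 2"
        "col' 1" "ori' 6" "col' 6" "col' 0" "col 1" "col' 3"]
      by (simp add: sign_def)
    done
qed

text \<open>
  Passing under the stem of a vertex amounts to passing under its two branches. When the end whose
  direction differs is the stem, this is the compatibility of \<open>\<lhd>\<close> and \<open>\<chi>\<close> with \<open>\<diamond>\<close> in the
  second argument. When it is a branch, the same identity holds with its terms moved to the other
  side: a loop around the vertex passes under the same three arcs in all cases.
\<close>

lemma passages_under_vertex:
  assumes "\<And>a b c. \<chi> a (b \<diamond> c) = \<chi> a b + \<chi> (a \<lhd> b) c"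
  assumes "vertex_rule s (\<not> r) (\<not> l) S R L" "passes s S a a2" "passes r R a a1" "passes l L a1 a2"
  shows "passage_weight \<chi> s S a a2 = passage_weight \<chi> r R a a1 + passage_weight \<chi> l L a1 a2"
  using assms(2-)
  by (cases s; cases r; cases l; clarsimp simp: vertex_rule_def passes_def
      passage_weight_def assms(1) rhd_cancel act_dia)

lemma weights_agree_R_IV:
  assumes "\<And>a b c. \<chi> a (b \<diamond> c) = \<chi> a b + \<chi> (a \<lhd> b) c"
  shows "weights_agree (qualgebra_weight \<chi> \<Lambda>)
     (Subdiagram
        [crossing False (Head 0) (Head 2) (Tail 1) (Tail 3),
         Vertex (Head 3) (Tail 5) (Tail 4)]
        [Tail 2, Head 1, Head 5, Head 4, Tail 0])
     (Subdiagram
        [Vertex (Head 3) (Tail 6) (Tail 4),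
         crossing False (Head 0) (Head 4) (Tail 1) (Tail 5),
         crossing False (Head 1) (Head 6) (Tail 2) (Tail 7)]
        [Tail 3, Head 2, Head 7, Head 5, Tail 0])"
  apply (clarsimp simp: local_rules)
  subgoal for ori ori' col col'
    using passages_under_vertex[where \<chi> = \<chi>, OF assms, of "ori' 3" "ori' 6" "ori' 4"]
    by (simp add: sign_def)
  done

text \<open>
  The branches of a vertex are exchanged by letting \<open>R\<close> pass under \<open>L\<close>. If the stem is the end
  whose direction differs, the swap identity \<open>h5\<close> is exactly what is needed. If it is \<open>L\<close>, then
  \<open>L\<close> is a product with \<open>R\<close> or \<open>R'\<close> as a factor, and \<open>h3\<close> and \<open>h2\<close> reduce the passage under
  \<open>L\<close> to one under \<open>S\<close>. If it is \<open>R\<close>, then a product with factors \<open>L\<close> and \<open>S\<close> passes under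
  \<open>L\<close>, and \<open>h4\<close> and \<open>h2\<close> reduce this passage to the one of \<open>S\<close>. In both cases \<open>h5\<close> concludes.
\<close>

lemma vertex_swap_branches:
  assumes h2: "\<And>a. \<chi> a a = 0"
    and h3: "\<And>a b c. \<chi> a (b \<diamond> c) = \<chi> a b + \<chi> (a \<lhd> b) c"
    and h4: "\<And>a b c. \<chi> (a \<diamond> b) c + \<Lambda> (a \<lhd> c) (b \<lhd> c) = \<chi> a c + \<chi> b c + \<Lambda> a b"
    and h5: "\<And>a b. \<chi> a b + \<Lambda> a b = \<Lambda> b (a \<lhd> b)"
  assumes v: "vertex_rule s (\<not> l) (\<not> r) S L R" "vertex_rule s (\<not> r) (\<not> l) S R' L"
     "passes (\<not> l) L R R'"
  shows "vertex_weight \<Lambda> s (\<not> l) (\<not> r) S L R =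
     vertex_weight \<Lambda> s (\<not> r) (\<not> l) S R' L - sign r * passage_weight \<chi> (\<not> l) L R R'"
  \<comment> \<open>The instances of \<open>h5\<close>, \<open>h4\<close> and \<open>h3\<close> belong to the six orientations. By the last fact and
    idempotence, passing \<open>R\<close> under the product \<open>L\<close> of \<open>R\<close> and \<open>S\<close> is passing it under \<open>S\<close>.\<close>
  using v h5[of R' L] h5[of R L] h5[of S L] h5[of R' S] h5[of R S] h4[of L S L]
    h3[of R' R' S] h3[of R R S] act_dia[of R R S]
  by (cases s; cases r; cases l; clarsimp simp: vertex_rule_def vertex_weight_def
      passes_def passage_weight_def sign_def h2 act_dia idempotent)

text \<open>
  A crossing can be walked through in either direction.
\<close>

lemma passes_reverse: "passes (\<not> \<epsilon>) b a a' \<longleftrightarrow> passes \<epsilon> b a' a"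
  by (simp add: passes_def)

lemma passage_weight_reverse: "passage_weight \<chi> (\<not> \<epsilon>) b a a' = - passage_weight \<chi> \<epsilon> b a' a"
  by (simp add: passage_weight_def)

text \<open>
  The left branch passes over the right one for one value of \<open>b\<close>, and under it for the other.
  Undoing the exchange of branches, that is, interchanging the two sides of the move, turns one
  situation into the other.
\<close>

lemma weights_agree_R_V:
  assumes "\<And>a. \<chi> a a = 0"
    "\<And>a b c. \<chi> a (b \<diamond> c) = \<chi> a b + \<chi> (a \<lhd> b) c"
    "\<And>a b c. \<chi> (a \<diamond> b) c + \<Lambda> (a \<lhd> c) (b \<lhd> c) = \<chi> a c + \<chi> b c + \<Lambda> a b"
    "\<And>a b. \<chi> a b + \<Lambda> a b = \<Lambda> b (a \<lhd> b)"
  shows "weights_agree (qualgebra_weight \<chi> \<Lambda>)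
     (Subdiagram [Vertex (Head 0) (Tail 2) (Tail 1)] [Tail 0, Head 2, Head 1])
     (Subdiagram
        [Vertex (Head 0) (Tail 2) (Tail 1),
         crossing b (Head 1) (Head 2) (Tail 3) (Tail 4)]
        [Tail 0, Head 3, Head 4])"
proof (cases b)
  case True
  then show ?thesis
    apply (clarsimp simp: local_rules)
    subgoal for ori ori' col col'
      by (rule vertex_swap_branches[where \<chi> = \<chi> and \<Lambda> = \<Lambda>, OF assms])
    done
next
  case False
  then show ?thesis
    apply (clarsimp simp: local_rules)
    subgoal for ori ori' col col'
      using vertex_swap_branches[where \<chi> = \<chi> and \<Lambda> = \<Lambda>, OF assms,
        of "ori' 0" "ori' 2" "ori' 1" "col' 0" "col' 2" "col' 1" "col' 3"]
      by (simp add: passes_reverse passage_weight_reverse)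
    done
qed

text \<open>
  Moving a vertex under an arc \<open>c\<close> moves its three ends. Since \<open>\<lhd> c\<close> respects \<open>\<diamond>\<close>, the identity
  \<open>h\<close> relates the weights of the vertex before and after, whichever end is the
  product of the other two; its direction decides the signs with which the passages enter.
\<close>

lemma vertex_through_passage:
  assumes h: "\<And>a b c. \<chi> (a \<diamond> b) c + \<Lambda> (a \<lhd> c) (b \<lhd> c) = \<chi> a c + \<chi> b c + \<Lambda> a b"
  assumes "vertex_rule s (\<not> r) (\<not> l) S R L" "vertex_rule s (\<not> r) (\<not> l) S' R' L'"
     "passes e c S S'" "passes e c R R'" "passes e c L L'"
  shows "vertex_weight \<Lambda> s (\<not> r) (\<not> l) S R L - sign s * passage_weight \<chi> e c S S' =
   vertex_weight \<Lambda> s (\<not> r) (\<not> l) S' R' L' - sign l * passage_weight \<chi> e c L L'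
     - sign r * passage_weight \<chi> e c R R'"
proof -
  have h': "\<Lambda> (a \<lhd> c) (b \<lhd> c) = \<chi> a c + \<chi> b c + \<Lambda> a b - \<chi> (a \<diamond> b) c" for a b
    using h[of a b c] by simp
  show ?thesis
    using assms(2-)
    by (cases s; cases r; cases l; cases e; clarsimp simp: vertex_rule_def vertex_weight_def
        passes_def passage_weight_def sign_def dia_distrib h')
qed

lemma weights_agree_R_VI:
  assumes "\<And>a b c. \<chi> (a \<diamond> b) c + \<Lambda> (a \<lhd> c) (b \<lhd> c) = \<chi> a c + \<chi> b c + \<Lambda> a b"
  shows "weights_agree (qualgebra_weight \<chi> \<Lambda>)
     (Subdiagram
        [crossing True (Head 0) (Head 2) (Tail 1) (Tail 3),
         Vertex (Head 3) (Tail 5) (Tail 4)]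
        [Tail 2, Head 1, Head 5, Head 4, Tail 0])
     (Subdiagram
        [Vertex (Head 3) (Tail 6) (Tail 4),
         crossing True (Head 0) (Head 4) (Tail 1) (Tail 5),
         crossing True (Head 1) (Head 6) (Tail 2) (Tail 7)]
        [Tail 3, Head 2, Head 7, Head 5, Tail 0])"
  apply (clarsimp simp: local_rules)
  subgoal for ori ori' col col'
    using vertex_through_passage[where \<chi> = \<chi> and \<Lambda> = \<Lambda>, OF assms,
      of "ori' 3" "ori' 6" "ori' 4" "col 3" "col' 7" "col' 5"
        "col' 3" "col' 6" "col' 4" "\<not> ori' 2" "col' 2"]
    by simp
  done

section \<open>Identities forced by the moves\<close>

text \<open>
  To be applied with explicit colors. In the instances below, \<open>(!) [x, y, z]\<close> gives segment 0
  the color \<open>x\<close>, segment 1 the color \<open>y\<close>, and so on.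
\<close>

lemma weights_agree_on_R_move:
  assumes "Boltzmann w" "R_move (Subdiagram ps bs) (Subdiagram ps' bs')"
    "\<forall>p\<in>set ps. valid_at ori col p" "\<forall>p\<in>set ps'. valid_at ori' col' p"
    "map (incoming ori) bs = map (incoming ori') bs'"
    "map (\<lambda>h. col (segment h)) bs = map (\<lambda>h. col' (segment h)) bs'"
  shows "segment_weight w ori col ps = segment_weight w ori' col' ps'"
proof -
  have "weights_agree w (Subdiagram ps bs) (Subdiagram ps' bs')"
    using assms(1,2) unfolding Boltzmann_iff_weights_agree by blast
  then show ?thesis
    using assms(3-) by simp
qed

context
  fixes \<chi> \<Lambda> :: "'q \<Rightarrow> 'q \<Rightarrow> int"
  assumes B: "Boltzmann (qualgebra_weight \<chi> \<Lambda>)"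
begin

text \<open>
  The strand starting at the bottom left is the lowest one. It ends at the top right with color
  \<open>a\<close>, and from there back to the bottom it crosses each of the other strands from right to left,
  so that every crossing applies \<open>\<lhd>\<close>.
\<close>

lemma Boltzmann_imp_cocycle: "\<chi> a b + \<chi> (a \<lhd> b) c = \<chi> (a \<lhd> c) (b \<lhd> c) + \<chi> a c"
  using weights_agree_on_R_move[OF B R_III[of False], where ori = "\<lambda>_. True" and ori' = "\<lambda>_. True"
    and col = "(!) [a \<lhd> c \<lhd> (b \<lhd> c), a \<lhd> c, a, b \<lhd> c, b \<lhd> c, b, c, c, c]"
    and col' = "(!) [a \<lhd> b \<lhd> c, a \<lhd> b, a, b \<lhd> c, b, b, c, c, c]"]
  by (simp add: local_rules passes_def passage_weight_def sign_def flip: self_distrib)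

lemma Boltzmann_imp_diagonal_zero: "\<chi> a a = 0"
  using weights_agree_on_R_move[OF B R_I[of False], where ori = "\<lambda>_. True" and ori' = "\<lambda>_. True"
    and col = "\<lambda>_. a" and col' = "\<lambda>_. a"]
  by (simp add: local_rules passes_def passage_weight_def sign_def idempotent)

lemma Boltzmann_imp_dia_over: "\<chi> a (b \<diamond> c) = \<chi> a b + \<chi> (a \<lhd> b) c"
  using weights_agree_on_R_move[OF B R_IV, where ori = "\<lambda>_. True" and ori' = "\<lambda>_. True"
    and col = "(!) [a \<lhd> (b \<diamond> c), a, b \<diamond> c, b \<diamond> c, c, b]"
    and col' = "(!) [a \<lhd> b \<lhd> c, a \<lhd> b, a, b \<diamond> c, c, c, b, b]"]
  by (simp add: local_rules passes_def passage_weight_def sign_def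
      vertex_rule_def vertex_weight_def act_dia)

text \<open>
  The over-strand is oriented from right to left, so that the branches of the vertex lie on its
  right and the three passages lead from \<open>a\<close>, \<open>b\<close> and \<open>a \<diamond> b\<close> to their images under \<open>\<lhd> c\<close>.
\<close>

lemma Boltzmann_imp_dia_under: "\<chi> (a \<diamond> b) c + \<Lambda> (a \<lhd> c) (b \<lhd> c) = \<chi> a c + \<chi> b c + \<Lambda> a b"
  using weights_agree_on_R_move[OF B R_VI, where ori = "\<lambda>i. 1 < i" and ori' = "\<lambda>i. 2 < i"
    and col = "(!) [c, c, (a \<diamond> b) \<lhd> c, a \<diamond> b, b, a]"
    and col' = "(!) [c, c, c, (a \<lhd> c) \<diamond> (b \<lhd> c), b \<lhd> c, b, a \<lhd> c, a]"]
  by (simp add: local_rules passes_def passage_weight_def sign_def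
      vertex_rule_def vertex_weight_def dia_distrib)

lemma Boltzmann_imp_swap: "\<chi> a b + \<Lambda> a b = \<Lambda> b (a \<lhd> b)"
  using weights_agree_on_R_move[OF B R_V[of True], where ori = "\<lambda>_. True" and ori' = "\<lambda>_. True"
    and col = "(!) [a \<diamond> b, a \<lhd> b, b]"
    and col' = "(!) [a \<diamond> b, b, a, b, a \<lhd> b]"]
  by (simp add: local_rules passes_def passage_weight_def sign_def
      vertex_rule_def vertex_weight_def flip: semi_comm)

end

end

section \<open>Boltzmann weight functions of a qualgebra\<close>

theorem proposition6p1:
  fixes rhd :: "'q \<Rightarrow> 'q \<Rightarrow> 'q" (infixl "\<lhd>" 70)
    and dia :: "'q \<Rightarrow> 'q \<Rightarrow> 'q" (infixl "\<diamond>" 70)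
    and \<chi> \<Lambda> :: "'q \<Rightarrow> 'q \<Rightarrow> int"
  assumes "qualgebra (\<lhd>) (\<diamond>)"
  shows "qualgebra.Boltzmann (\<lhd>) (\<diamond>) (qualgebra_weight \<chi> \<Lambda>) \<longleftrightarrow>
    (\<forall>a b c.
       \<chi> a b + \<chi> (a \<lhd> b) c = \<chi> (a \<lhd> c) (b \<lhd> c) + \<chi> a c \<and>
       \<chi> a a = 0 \<and>
       \<chi> a (b \<diamond> c) = \<chi> a b + \<chi> (a \<lhd> b) c \<and>
       \<chi> (a \<diamond> b) c + \<Lambda> (a \<lhd> c) (b \<lhd> c) = \<chi> a c + \<chi> b c + \<Lambda> a b \<and>
       \<chi> a b + \<Lambda> a b = \<Lambda> b (a \<lhd> b))"
proof
  interpret qualgebra "(\<lhd>)" "(\<diamond>)" by (fact assms)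
  let ?w = "qualgebra_weight \<chi> \<Lambda>"
  assume B: "Boltzmann ?w"
  show "\<forall>a b c.
       \<chi> a b + \<chi> (a \<lhd> b) c = \<chi> (a \<lhd> c) (b \<lhd> c) + \<chi> a c \<and>
       \<chi> a a = 0 \<and>
       \<chi> a (b \<diamond> c) = \<chi> a b + \<chi> (a \<lhd> b) c \<and>
       \<chi> (a \<diamond> b) c + \<Lambda> (a \<lhd> c) (b \<lhd> c) = \<chi> a c + \<chi> b c + \<Lambda> a b \<and>
       \<chi> a b + \<Lambda> a b = \<Lambda> b (a \<lhd> b)"
    using Boltzmann_imp_cocycle[OF B] Boltzmann_imp_diagonal_zero[OF B]
      Boltzmann_imp_dia_over[OF B] Boltzmann_imp_dia_under[OF B] Boltzmann_imp_swap[OF B]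
    by (intro allI conjI)
next
  interpret qualgebra "(\<lhd>)" "(\<diamond>)" by (fact assms)
  let ?w = "qualgebra_weight \<chi> \<Lambda>"
  assume identities: "\<forall>a b c.
       \<chi> a b + \<chi> (a \<lhd> b) c = \<chi> (a \<lhd> c) (b \<lhd> c) + \<chi> a c \<and>
       \<chi> a a = 0 \<and>
       \<chi> a (b \<diamond> c) = \<chi> a b + \<chi> (a \<lhd> b) c \<and>
       \<chi> (a \<diamond> b) c + \<Lambda> (a \<lhd> c) (b \<lhd> c) = \<chi> a c + \<chi> b c + \<Lambda> a b \<and>
       \<chi> a b + \<Lambda> a b = \<Lambda> b (a \<lhd> b)"
  have h1: "\<chi> a b + \<chi> (a \<lhd> b) c = \<chi> (a \<lhd> c) (b \<lhd> c) + \<chi> a c" for a b c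
    using identities by blast
  have h2: "\<chi> a a = 0" for a
    using identities by blast
  have h3: "\<chi> a (b \<diamond> c) = \<chi> a b + \<chi> (a \<lhd> b) c" for a b c
    using identities by blast
  have h4: "\<chi> (a \<diamond> b) c + \<Lambda> (a \<lhd> c) (b \<lhd> c) = \<chi> a c + \<chi> b c + \<Lambda> a b" for a b c
    using identities by blast
  have h5: "\<chi> a b + \<Lambda> a b = \<Lambda> b (a \<lhd> b)" for a b
    using identities by blast
  have "weights_agree ?w D D'" if "R_move D D'" for D D'
    using that
  proof cases
    case R_I
    then show ?thesis by (simp only: weights_agree_R_I[where \<chi> = \<chi>, OF h2])
  next
    case R_II
    then show ?thesis by (simp only: weights_agree_R_II)
  next
    case R_III
    then show ?thesis by (simp only: weights_agree_R_III[where \<chi> = \<chi>, OF h1])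
  next
    case R_IV
    then show ?thesis by (simp only: weights_agree_R_IV[where \<chi> = \<chi>, OF h3])
  next
    case R_V
    then show ?thesis
      by (simp only: weights_agree_R_V[where \<chi> = \<chi> and \<Lambda> = \<Lambda>, OF h2 h3 h4 h5])
  next
    case R_VI
    then show ?thesis
      by (simp only: weights_agree_R_VI[where \<chi> = \<chi> and \<Lambda> = \<Lambda>, OF h4])
  qed
  then show "Boltzmann ?w"
    unfolding Boltzmann_iff_weights_agree by blast
qed

end
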